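(* Let $f\in C^1(\mathbb{R}^d,\mathbb{R}^d)$ and let $x(t;x_0)$, $t\ge0$, be a trajectory of the dynamical system $\dot x(t)=f(x)$ which falls into a hyperbolic sink $p$ as $t\to\infty$. Then its $E(t)$ is bounded above by a constant for all $t\ge0$.
   Context: Norms are Euclidean. A hyperbolic sink is a point $p$ with $f(p)=0$ such that all eigenvalues of $\frac{\partial f}{\partial x}\big|_{x=p}$ have strictly negative real parts. $x(t;x_0)$ denotes the solution with $x(0)=x_0$; "falls into $p$" means $x(t;x_0)\to p$ as $t\to\infty$. Definition of $E$: let $\dot y=F(t,y)$ with $F(t,0)\equiv0$, $F$ continuous in $t$ and locally Lipschitz in $y$, and let $y(t;s,\eta)$ denote the solution with $y(s)=\eta$. Let $\alpha:[0,\infty)\to[0,\infty)$ be any continuous strictly increasing function with $\alpha(0)=0$. For $h>0$ the family $\tilde Y_\alpha(h)$ of approximations to the zero solution consists of all functions $\tilde y(\cdot;h)$ obtained from sequences $v_1,v_2,\dots\in\mathbb{R}^d$ with $\|v_n\|\le 1$ by $\tilde y(0;h)=0$, $\tilde y(nh;h)=y(nh;(n-1)h,\tilde y((n-1)h;h))+h\alpha(h)v_n$ for $n\ge1$, and $\tilde y(t;h)=y(t;(n-1)h,\tilde y((n-1)h;h))$ for $(n-1)h\le t<nh$. For every $T>0$ all these approximations exist on $[0,T]$ once $h$ is small enough. Define $e_\alpha(t;h)=\sup_{\tilde y\in\tilde Y_\alpha(h)}\|\tilde y(t;h)\|$ and $E(t)=E_\alpha(t)=\limsup_{h\to0^+}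 e_\alpha(t;h)/\alpha(h)$; this value does not depend on the choice of $\alpha$. The $E(t)$ of a trajectory $x(t;x_0)$ of $\dot x=f(x)$ is by definition the $E(t)$ of the zero solution of $\dot y=f(y+x(t;x_0))-f(x(t;x_0))$. *)

theory Defs
  imports "HOL-Analysis.Analysis"
begin

definition C1_map :: "(real ^ 'd \<Rightarrow> real ^ 'd) \<Rightarrow> bool" where
  "C1_map f \<longleftrightarrow> f differentiable_on UNIV \<and> continuous_on UNIV (\<lambda>x. jacobian f (at x))"

definition matrix_eigenvalue :: "'a::field ^ 'd ^ 'd \<Rightarrow> 'a \<Rightarrow> bool" where
  "matrix_eigenvalue A \<mu> \<longleftrightarrow> (\<exists>v. v \<noteq> 0 \<and> A *v v = \<mu> *s v)"

(* The eigenvalues of the real Jacobian are the complex ones. *)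
definition hyperbolic_sink :: "(real ^ 'd \<Rightarrow> real ^ 'd) \<Rightarrow> real ^ 'd \<Rightarrow> bool" where
  "hyperbolic_sink f p \<longleftrightarrow> f p = 0 \<and>
     (\<forall>\<mu>::complex. matrix_eigenvalue (map_matrix complex_of_real (jacobian f (at p))) \<mu> \<longrightarrow> Re \<mu> < 0)"

definition trajectory :: "(real ^ 'd \<Rightarrow> real ^ 'd) \<Rightarrow> real ^ 'd \<Rightarrow> (real \<Rightarrow> real ^ 'd) \<Rightarrow> bool" where
  "trajectory f x0 x \<longleftrightarrow> x 0 = x0 \<and>
     (\<forall>t\<ge>0. (x has_vector_derivative f (x t)) (at t within {0..}))"

(* value_at F s \<eta> t w means that y(t;s,\<eta>) exists and equals w, for t \<ge> s, where y(.;s,\<eta>) solves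
   y' = F(t,y), y(s) = \<eta>.  A relation, because solutions may blow up before time t; w is
   unique when F is continuous in t and locally Lipschitz in y. *)
definition value_at ::
    "(real \<Rightarrow> real ^ 'd \<Rightarrow> real ^ 'd) \<Rightarrow> real \<Rightarrow> real ^ 'd \<Rightarrow> real \<Rightarrow> real ^ 'd \<Rightarrow> bool" where
  "value_at F s \<eta> t w \<longleftrightarrow>
     (\<exists>y. y s = \<eta> \<and> y t = w \<and>
        (\<forall>\<tau>\<in>{s..t}. (y has_vector_derivative F \<tau> (y \<tau>)) (at \<tau> within {s..t})))"

(* The approximations on [0,T]; values of yt outside [0,T] are unconstrained.  Approximations
   that blow up before T are absent; for F continuous in t and locally Lipschitz in y with
   F t 0 = 0, there are none of these once h is small, so the limit superior in error_growth
   does not see them. *)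
definition approximations ::
    "(real \<Rightarrow> real ^ 'd \<Rightarrow> real ^ 'd) \<Rightarrow> (real \<Rightarrow> real) \<Rightarrow> real \<Rightarrow> real \<Rightarrow> (real \<Rightarrow> real ^ 'd) set" where
  "approximations F \<alpha> h T = {yt. \<exists>v :: nat \<Rightarrow> real ^ 'd.
     (\<forall>n\<ge>1. norm (v n) \<le> 1) \<and>
     yt 0 = 0 \<and>
     (\<forall>n\<ge>1. real n * h \<le> T \<longrightarrow>
        (\<exists>w. value_at F (real (n - 1) * h) (yt (real (n - 1) * h)) (real n * h) w \<and>
             yt (real n * h) = w + (h * \<alpha> h) *\<^sub>R v n)) \<and>
     (\<forall>n\<ge>1. \<forall>t\<in>{real (n - 1) * h..<real n * h}. t \<le> T \<longrightarrow>
        value_at F (real (n - 1) * h) (yt (real (n - 1) * h)) t (yt t))}"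

definition max_error ::
    "(real \<Rightarrow> real ^ 'd \<Rightarrow> real ^ 'd) \<Rightarrow> (real \<Rightarrow> real) \<Rightarrow> real \<Rightarrow> real \<Rightarrow> ereal" where
  "max_error F \<alpha> t h = (SUP yt \<in> approximations F \<alpha> h t. ereal (norm (yt t)))"

definition error_growth ::
    "(real \<Rightarrow> real ^ 'd \<Rightarrow> real ^ 'd) \<Rightarrow> (real \<Rightarrow> real) \<Rightarrow> real \<Rightarrow> ereal" where
  "error_growth F \<alpha> t = Limsup (at_right 0) (\<lambda>h. max_error F \<alpha> t h / ereal (\<alpha> h))"

definition admissible_scale :: "(real \<Rightarrow> real) \<Rightarrow> bool" where
  "admissible_scale \<alpha> \<longleftrightarrow> continuous_on {0..} \<alpha> \<and> strict_mono_on {0..} \<alpha> \<and> \<alpha> 0 = 0"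

definition trajectory_error_growth ::
    "(real ^ 'd \<Rightarrow> real ^ 'd) \<Rightarrow> (real \<Rightarrow> real ^ 'd) \<Rightarrow> (real \<Rightarrow> real) \<Rightarrow> real \<Rightarrow> ereal" where
  "trajectory_error_growth f x = error_growth (\<lambda>t y. f (y + x t) - f (x t))"

end

theory Submission
  imports Defs "HOL-Computational_Algebra.Fundamental_Theorem_Algebra"
begin

text \<open>The Jacobian \<open>A\<close> at the sink admits an inner product \<open>B\<close> with
  \<open>B(y, A y) \<le> - \<beta> B(y, y)\<close>. Near \<open>p\<close> the nonlinear perturbation equation therefore contracts
  \<open>B(y, y)\<close>, and on the compact remainder of the trajectory \<open>B(y, y)\<close> grows at most exponentially.
  The bounded time-dependent factor \<open>exp (- C (1 - exp (- t)))\<close> absorbs this growth, so the weighted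
  norm \<open>N t y = sqrt (exp (- C (1 - exp (- t))) B(y, y))\<close> of a small solution decays like
  \<open>exp (- \<gamma> t)\<close> for all times. One step of length \<open>h\<close> maps \<open>N \<le> K \<alpha>(h)\<close> to
  \<open>N \<le> exp (- \<gamma> h) K \<alpha>(h) + c h \<alpha>(h)\<close>, which is again at most \<open>K \<alpha>(h)\<close> when \<open>K = 2 c / \<gamma>\<close> and
  \<open>\<gamma> h \<le> 1\<close>.\<close>

section \<open>Quadratic Lyapunov functions\<close>

text \<open>This is \<open>q(M) y\<close> by Horner's scheme, with \<open>M\<close> applied to the
  argument rather than to the result, so the calculus runs on vectors by induction on the
  coefficients.\<close>

definition poly_act :: "complex ^ 'd ^ 'd \<Rightarrow> complex poly \<Rightarrow> complex ^ 'd \<Rightarrow> complex ^ 'd" where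
  "poly_act M q = fold_coeffs (\<lambda>a g y. a *s y + g (M *v y)) q (\<lambda>_. 0)"

lemma poly_act_0 [simp]: "poly_act M 0 y = 0"
  by (simp add: poly_act_def)

lemma poly_act_pCons [simp]: "poly_act M (pCons a q) y = a *s y + poly_act M q (M *v y)"
  by (cases "a = 0 \<and> q = 0") (auto simp: poly_act_def)

lemma poly_act_add: "poly_act M (p + q) y = poly_act M p y + poly_act M q y"
proof (induction p q arbitrary: y rule: poly_induct2)
  case (pCons a p b q)
  then show ?case by (simp add: vector_sadd_rdistrib algebra_simps)
qed simp

lemma poly_act_smult: "poly_act M (smult c q) y = c *s poly_act M q y"
  by (induction q arbitrary: y) (auto simp: vector_add_ldistrib vector_smult_assoc)

lemma poly_act_diff_vec: "poly_act M q (y - z) = poly_act M q y - poly_act M q z"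
  by (induction q arbitrary: y z)
    (auto simp: algebra_simps vector_sub_rdistrib vector_ssub_ldistrib matrix_vector_mult_diff_distrib)

lemma poly_act_scale_vec: "poly_act M q (c *s y) = c *s poly_act M q y"
  by (induction q arbitrary: y)
    (auto simp: vector_add_ldistrib vector_smult_assoc mult.commute vector_scalar_commute)

lemma poly_act_matrix_vec: "poly_act M q (M *v y) = M *v poly_act M q y"
  by (induction q arbitrary: y)
    (auto simp: matrix_vector_right_distrib vector_scalar_commute)

text \<open>The factor \<open>M - \<mu>\<close> is moved onto the argument, which is the shape of
  the recursion of \<open>root_prod\<close>.\<close>

lemma poly_act_linear_factor: "poly_act M ([:-\<mu>, 1:] * q) y = poly_act M q (M *v y - \<mu> *s y)"
proof -
  have "[:-\<mu>, 1:] * q = smult (-\<mu>) q + pCons 0 q" by simp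
  then show ?thesis
    by (simp only: poly_act_add poly_act_smult poly_act_pCons poly_act_diff_vec poly_act_scale_vec)
      (simp add: vector_smult_lneg)
qed

lemma poly_act_sum: "finite I \<Longrightarrow> poly_act M (\<Sum>i\<in>I. g i) y = (\<Sum>i\<in>I. poly_act M (g i) y)"
  by (induction I rule: finite_induct) (auto simp: poly_act_add)

primrec matrix_pow :: "'a::semiring_1 ^ 'd ^ 'd \<Rightarrow> nat \<Rightarrow> 'a ^ 'd ^ 'd" where
  "matrix_pow M 0 = mat 1"
| "matrix_pow M (Suc n) = matrix_pow M n ** M"

lemma poly_act_monom: "poly_act M (monom c n) y = c *s (matrix_pow M n *v y)"
  by (induction n arbitrary: y) (auto simp: monom_0 monom_Suc matrix_vector_mul_assoc)

section \<open>Annihilating polynomials and their stable factors\<close>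

text \<open>More vectors than the dimension are dependent. For sequences a repeated value is already
  a dependence, hence the split on injectivity.\<close>

lemma finite_sequence_dependent:
  fixes g :: "nat \<Rightarrow> 'a::euclidean_space"
  obtains c n i where "i \<le> n" "c i \<noteq> (0::real)" "(\<Sum>i\<le>n. c i *\<^sub>R g i) = 0"
proof (cases "inj g")
  case True
  define n where "n = DIM('a)"
  have inj: "inj_on g {..n}" using True by (rule inj_on_subset) simp
  then have "card (g ` {..n}) > DIM('a)" by (simp add: card_image n_def)
  then have "dependent (g ` {..n})" by (intro dependent_biggerset)
  then obtain u v where v: "v \<in> g ` {..n}" "u v \<noteq> 0" and s: "(\<Sum>v\<in>g ` {..n}. u v *\<^sub>R v) = 0"
    by (auto simp: dependent_finite)
  from v obtain i where "i \<le> n" "u (g i) \<noteq> 0" by auto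
  moreover have "(\<Sum>i\<le>n. u (g i) *\<^sub>R g i) = 0" using s by (simp add: sum.reindex[OF inj])
  ultimately show ?thesis by (rule that[where c = "\<lambda>i. u (g i)"])
next
  case False
  then obtain i j where ij: "i < j" "g i = g j"
    by (metis injI linorder_neqE_nat)
  define c where "c k = (if k = i then 1 else if k = j then - 1 else 0 :: real)" for k
  have "(\<Sum>k\<le>j. c k *\<^sub>R g k) = (\<Sum>k\<in>{i, j}. c k *\<^sub>R g k)"
    using ij by (intro sum.mono_neutral_right) (auto simp: c_def)
  also have "\<dots> = 0" using ij by (simp add: c_def)
  finally show ?thesis using ij by (intro that[of i j c]) (auto simp: c_def)
qed

lemma scaleR_eq_smult: "r *\<^sub>R y = complex_of_real r *s y"
  by (simp add: vec_eq_iff) (simp add: scaleR_conv_of_real)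

text \<open>The powers of \<open>M\<close> lie in a finite-dimensional real vector space, so a
  nontrivial real combination of them vanishes; its coefficients form \<open>q\<close>.\<close>

lemma ex_annihilating_poly:
  fixes M :: "complex ^ 'd ^ 'd"
  obtains q where "q \<noteq> 0" "\<And>y. poly_act M q y = 0"
proof -
  obtain c n i where c: "i \<le> n" "c i \<noteq> (0::real)" "(\<Sum>i\<le>n. c i *\<^sub>R matrix_pow M i) = 0"
    by (rule finite_sequence_dependent)
  define q where "q = (\<Sum>i\<le>n. monom (complex_of_real (c i)) i)"
  have "coeff q i = c i" using c(1) by (simp add: q_def coeff_sum if_distrib cong: if_cong)
  then have "q \<noteq> 0" using c(2) by auto
  moreover have "poly_act M q y = 0" for y
  proof -
    have "poly_act M q y = (\<Sum>i\<le>n. c i *\<^sub>R (matrix_pow M i *v y))"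
      by (simp add: q_def poly_act_sum poly_act_monom scaleR_eq_smult)
    also have "\<dots> = (\<Sum>i\<le>n. c i *\<^sub>R matrix_pow M i) *v y"
      by (simp add: vec_eq_iff matrix_vector_mult_def sum_distrib_right scaleR_right.sum
          sum.swap[of _ _ "{..n}"])
    finally show ?thesis using c(3) by simp
  qed
  ultimately show ?thesis by (rule that)
qed

text \<open>The product of the factors \<open>M - \<mu>\<close> over the list, applied to
  \<open>y\<close>. A list of roots lets later inductions peel off one factor at a time.\<close>

primrec root_prod :: "complex ^ 'd ^ 'd \<Rightarrow> complex list \<Rightarrow> complex ^ 'd \<Rightarrow> complex ^ 'd" where
  "root_prod M [] y = y"
| "root_prod M (\<mu> # ms) y = root_prod M ms (M *v y - \<mu> *s y)"

text \<open>Linear factors whose root is not an eigenvalue are invertible and can be cancelled.\<close>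

lemma annihilating_root_prod:
  fixes M :: "complex ^ 'd ^ 'd"
  assumes stable: "\<And>\<mu>. matrix_eigenvalue M \<mu> \<Longrightarrow> Re \<mu> < 0" and "q \<noteq> 0"
  shows "\<exists>ms. (\<forall>\<mu>\<in>set ms. Re \<mu> < 0) \<and> (\<forall>y. poly_act M q y = 0 \<longrightarrow> root_prod M ms y = 0)"
  using \<open>q \<noteq> 0\<close>
proof (induction "degree q" arbitrary: q)
  case 0
  then obtain c where "q = [:c:]" "c \<noteq> 0"
    by (metis degree_0_id pCons_0_0 of_nat_eq_0_iff degree_eq_zeroE)
  \<comment> \<open>A nonzero constant annihilates only \<open>y = 0\<close>, so the empty product
    does.\<close>
  then show ?case by (intro exI[of _ "[]"]) (auto simp: vector_mul_eq_0)
next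
  case (Suc n)
  then have "\<not> constant (poly q)" by (simp add: constant_degree)
  then obtain \<mu> where "poly q \<mu> = 0" using fundamental_theorem_of_algebra by blast
  then obtain q' where q: "q = [:-\<mu>, 1:] * q'" by (auto simp: poly_eq_0_iff_dvd)
  with Suc.prems have "q' \<noteq> 0" by auto
  then have "degree q = Suc (degree q')" using q degree_mult_eq[of "[:-\<mu>, 1:]" q'] by simp
  with Suc.hyps(2) have "n = degree q'" by simp
  then obtain ms where ms: "\<forall>\<mu>\<in>set ms. Re \<mu> < 0" "\<And>y. poly_act M q' y = 0 \<Longrightarrow> root_prod M ms y = 0"
    using Suc.hyps(1) \<open>q' \<noteq> 0\<close> by blast
  show ?case
  proof (cases "Re \<mu> < 0")
    case True
    then show ?thesis using ms
      by (intro exI[of _ "\<mu> # ms"]) (simp add: q poly_act_linear_factor del: mult_pCons_left)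
  next
    case False
    \<comment> \<open>If nonzero, \<open>poly_act M q' y\<close> would be an eigenvector for
      \<open>\<mu>\<close>.\<close>
    have "poly_act M q' y = 0" if "poly_act M q y = 0" for y
    proof -
      have "M *v poly_act M q' y = \<mu> *s poly_act M q' y"
        using that by (simp add: q poly_act_linear_factor poly_act_diff_vec poly_act_scale_vec
            poly_act_matrix_vec del: mult_pCons_left)
      then show ?thesis using False stable[of \<mu>] by (auto simp: matrix_eigenvalue_def)
    qed
    then show ?thesis using ms by blast
  qed
qed

section \<open>Construction of the quadratic form\<close>

lemma bounded_bilinear_plus:
  assumes "bounded_bilinear f" "bounded_bilinear g"
  shows "bounded_bilinear (\<lambda>x y. f x y + g x y)"
proof -
  interpret f: bounded_bilinear f by fact
  interpret g: bounded_bilinear g by fact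
  obtain K L where KL: "\<And>a b. norm (f a b) \<le> norm a * norm b * K" "\<And>a b. norm (g a b) \<le> norm a * norm b * L"
    using f.bounded g.bounded by blast
  have "norm (f a b + g a b) \<le> norm a * norm b * (K + L)" for a b
    using norm_triangle_le[OF add_mono[OF KL]] by (simp add: algebra_simps)
  then show ?thesis
    by (intro bounded_bilinear.intro exI[of _ "K + L"] allI)
      (auto simp: f.add_left f.add_right g.add_left g.add_right f.scaleR_left
        f.scaleR_right g.scaleR_left g.scaleR_right scaleR_right_distrib)
qed

text \<open>Multiplication by the imaginary part turns each coordinate by a right angle and so
  contributes nothing to the real inner product.\<close>

lemma inner_vector_scalar_mult_left:
  fixes y :: "complex ^ 'd"
  shows "y \<bullet> (\<mu> *s y) = Re \<mu> * (y \<bullet> y)"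
proof -
  have "z \<bullet> (\<mu> * z) = Re \<mu> * (z \<bullet> z)" for z
    by (simp add: inner_complex_def algebra_simps)
  then show ?thesis by (simp add: inner_vec_def sum_distrib_left)
qed

text \<open>Along \<open>y' = M y\<close>, the iterates \<open>w\<^sub>0 = y\<close>, \<open>w\<^sub>i = (M - \<mu>\<^sub>i) w\<^sub>i\<^sub>-\<^sub>1\<close> form the triangular
  system \<open>w\<^sub>i\<^sub>-\<^sub>1' = \<mu>\<^sub>i w\<^sub>i\<^sub>-\<^sub>1 + w\<^sub>i\<close>, and a sum of \<open>\<parallel>w\<^sub>i\<parallel>\<^sup>2\<close> with rapidly increasing weights
  absorbs the coupling terms.\<close>

lemma root_prod_lyapunov:
  fixes M :: "complex ^ 'd ^ 'd"
  assumes "\<forall>\<mu>\<in>set ms. Re \<mu> < 0"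
  shows "\<exists>B \<beta>. bounded_bilinear B \<and> (\<forall>y z. B y z = B z y) \<and> (\<forall>y. B y y \<ge> (0::real)) \<and> \<beta> > 0 \<and>
    (\<forall>y. root_prod M ms y = 0 \<longrightarrow> norm y ^ 2 \<le> B y y \<and> B y (M *v y) \<le> - \<beta> * B y y)"
  using assms
proof (induction ms)
  case Nil
  have "bounded_bilinear (\<lambda>(y::complex ^ 'd) (z::complex ^ 'd). 0::real)"
    by (rule bounded_bilinear.intro) (auto intro!: exI[of _ 0])
  \<comment> \<open>The empty product vanishes only at \<open>y = 0\<close>, so the zero form works
    with any positive rate.\<close>
  then show ?case by (intro exI[of _ "\<lambda>y z. 0"] exI[of _ 1]) auto
next
  case (Cons \<mu> ms)
  then obtain B \<beta> where B: "bounded_bilinear B" "\<And>y z. B y z = B z y" "\<And>y. B y y \<ge> (0::real)"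
    and \<beta>: "\<beta> > 0" and lyap: "\<And>y. root_prod M ms y = 0 \<Longrightarrow> norm y ^ 2 \<le> B y y"
      "\<And>y. root_prod M ms y = 0 \<Longrightarrow> B y (M *v y) \<le> - \<beta> * B y y"
    by auto
  define a where "a = - Re \<mu>"
  have a: "a > 0" using Cons.prems by (simp add: a_def)
  \<comment> \<open>With this weight the coupling cost \<open>1 / (2 * a) * B u u\<close> is exactly
    half of the decay \<open>c * \<beta> * B u u\<close> of the inner form.\<close>
  define c where "c = 1 / (a * \<beta>)"
  have c: "c > 0" using a \<beta> by (simp add: c_def)
  define T where "T y = M *v y - \<mu> *s y" for y
  \<comment> \<open>Since \<open>T\<close> commutes with \<open>M\<close>, the induction hypothesis
    at \<open>u = T y\<close> also controls \<open>T (M *v y) = M *v u\<close>.\<close>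
  have TM: "T (M *v y) = M *v T y" for y
    by (simp add: T_def matrix_vector_mult_diff_distrib vector_scalar_commute)
  have "linear T"
    by (rule linearI) (auto simp: T_def algebra_simps vector_scalar_commute vector_add_ldistrib
        vector_ssub_ldistrib vector_smult_assoc scaleR_eq_smult)
  then have T: "bounded_linear T" by (rule linear_conv_bounded_linear[THEN iffD1])
  define B' where "B' y z = y \<bullet> z + c * B (T y) (T z)" for y z
  have "bounded_bilinear (\<lambda>y z. B (c *\<^sub>R T y) (T z))"
    by (rule bounded_bilinear.comp[OF B(1) bounded_linear_const_scaleR[OF T] T])
  then have "bounded_bilinear (\<lambda>y z. c * B (T y) (T z))"
    by (simp add: bounded_bilinear.scaleR_left[OF B(1)])
  then have "bounded_bilinear B'"
    unfolding B'_def by (intro bounded_bilinear_plus bounded_bilinear_inner)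
  moreover have "B' y z = B' z y" for y z
    using B(2) by (simp add: B'_def inner_commute)
  moreover have "B' y y \<ge> norm y ^ 2" for y
    using B(3) c by (simp add: B'_def dot_square_norm)
  moreover from this have "B' y y \<ge> 0" for y
    by (meson order_trans zero_le_power2)
  moreover have "B' y (M *v y) \<le> - min (a/2) (\<beta>/2) * B' y y" if "root_prod M (\<mu> # ms) y = 0" for y
  proof -
    define u where "u = T y"
    have u: "norm u ^ 2 \<le> B u u" "B u (M *v u) \<le> - \<beta> * B u u"
      using lyap[of u] that by (auto simp: u_def T_def)
    have "M *v y = \<mu> *s y + u" by (simp add: u_def T_def)
    then have "y \<bullet> (M *v y) = - a * norm y ^ 2 + y \<bullet> u"
      by (simp add: inner_add_right inner_vector_scalar_mult_left a_def dot_square_norm)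
    \<comment> \<open>Young's inequality, balanced to leave half of the decay
      \<open>a * norm y ^ 2\<close>.\<close>
    also have "y \<bullet> u \<le> a / 2 * norm y ^ 2 + 1 / (2 * a) * norm u ^ 2"
    proof -
      have "0 \<le> norm (a *\<^sub>R y - u) ^ 2" by simp
      also have "\<dots> = a^2 * norm y ^ 2 - 2 * a * (y \<bullet> u) + norm u ^ 2"
        unfolding power2_norm_eq_inner by (simp add: inner_diff_left inner_diff_right inner_commute
            power2_eq_square algebra_simps)
      finally show ?thesis using a by (simp add: field_simps power2_eq_square)
    qed
    finally have 1: "y \<bullet> (M *v y) \<le> - (a / 2) * norm y ^ 2 + 1 / (2 * a) * norm u ^ 2"
      by (simp add: algebra_simps)
    have 2: "1 / (2 * a) * norm u ^ 2 \<le> 1 / (2 * a) * B u u"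
      using u(1) a by (intro mult_left_mono) auto
    have 3: "c * B u (M *v u) \<le> c * (- \<beta> * B u u)"
      using u(2) c by (intro mult_left_mono) auto
    have 4: "1 / (2 * a) * B u u = c * (\<beta> / 2 * B u u)"
      using \<beta> by (simp add: c_def)
    have "B' y (M *v y) = y \<bullet> (M *v y) + c * B u (M *v u)"
      by (simp add: B'_def TM u_def)
    also have "\<dots> \<le> - (a / 2) * norm y ^ 2 - \<beta> / 2 * (c * B u u)"
      using 1 2 3 unfolding 4 by (simp add: algebra_simps)
    also have "\<dots> \<le> - min (a/2) (\<beta>/2) * norm y ^ 2 - min (a/2) (\<beta>/2) * (c * B u u)"
    proof -
      have "min (a/2) (\<beta>/2) * norm y ^ 2 \<le> a / 2 * norm y ^ 2"
        by (intro mult_right_mono) auto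
      moreover have "min (a/2) (\<beta>/2) * (c * B u u) \<le> \<beta> / 2 * (c * B u u)"
        using c B(3)[of u] by (intro mult_right_mono) auto
      ultimately show ?thesis by simp
    qed
    also have "\<dots> = - min (a/2) (\<beta>/2) * B' y y"
      by (simp add: B'_def u_def dot_square_norm algebra_simps)
    finally show ?thesis .
  qed
  moreover have "min (a/2) (\<beta>/2) > 0" using a \<beta> by simp
  ultimately show ?case by blast
qed

text \<open>The full root list annihilates every complex vector, so its form is a Lyapunov function
  everywhere. It is pulled back along \<open>cv\<close>, an isometry that intertwines
  \<open>A\<close> with its complexification.\<close>

lemma stable_matrix_lyapunov:
  fixes A :: "real ^ 'd ^ 'd"
  assumes "\<And>\<mu>::complex. matrix_eigenvalue (map_matrix complex_of_real A) \<mu> \<Longrightarrow> Re \<mu> < 0"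
  obtains B \<beta> where "bounded_bilinear B" "\<And>y z. B y z = (B z y :: real)" "\<And>y. norm y ^ 2 \<le> B y y"
    "\<beta> > 0" "\<And>y. B y (A *v y) \<le> - \<beta> * B y y"
proof -
  let ?M = "map_matrix complex_of_real A"
  define cv where "cv y = (\<chi> i. complex_of_real (y $ i))" for y :: "real ^ 'd"
  obtain q where "q \<noteq> 0" "\<And>y. poly_act ?M q y = 0" using ex_annihilating_poly[of ?M] by blast
  then obtain ms where ms: "\<forall>\<mu>\<in>set ms. Re \<mu> < 0" "\<And>y. root_prod ?M ms y = 0"
    using annihilating_root_prod[OF assms] by metis
  then obtain B \<beta> where B: "bounded_bilinear B" "\<And>y z. B y z = (B z y :: real)" "\<beta> > 0"
      "\<And>y. norm y ^ 2 \<le> B y y" "\<And>y. B y (?M *v y) \<le> - \<beta> * B y y"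
    using root_prod_lyapunov[OF ms(1), of ?M] by auto
  have "linear cv" by (rule linearI) (auto simp: cv_def vec_eq_iff complex_eq_iff)
  then have cv: "bounded_linear cv" by (rule linear_conv_bounded_linear[THEN iffD1])
  have cv_mult: "cv (A *v y) = ?M *v cv y" for y
    by (simp add: cv_def vec_eq_iff matrix_vector_mult_def)
  have "norm (cv y) = norm y" for y
    by (simp add: cv_def norm_vec_def)
  then have "norm y ^ 2 \<le> B (cv y) (cv y)" for y using B(4)[of "cv y"] by simp
  then show ?thesis using B(2,3) B(5)[of "cv _"]
    by (intro that[of "\<lambda>y z. B (cv y) (cv z)" \<beta>] bounded_bilinear.comp[OF B(1) cv cv])
      (auto simp: cv_mult)
qed

section \<open>Decay along trajectories\<close>

lemma bilinear_cauchy_schwarz: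
  fixes B :: "'a::real_normed_vector \<Rightarrow> 'a \<Rightarrow> real"
  assumes B: "bounded_bilinear B" and sym: "\<And>y z. B y z = B z y" and pos: "\<And>y. B y y \<ge> 0"
  shows "(B y z)\<^sup>2 \<le> B y y * B z z"
proof -
  interpret bounded_bilinear B by fact
  have *: "0 \<le> a\<^sup>2 * B y y + 2 * a * b * B y z + b\<^sup>2 * B z z" for a b
    using pos[of "a *\<^sub>R y + b *\<^sub>R z"] sym[of z y]
    by (simp add: add_left add_right scaleR_left scaleR_right power2_eq_square algebra_simps)
  show ?thesis
  proof (cases "B z z = 0")
    case True
    have "B y z = 0"
    proof (rule ccontr)
      assume "B y z \<noteq> 0"
      then show False
        \<comment> \<open>For \<open>B z z = 0\<close> the quadratic is affine in \<open>b\<close>,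
          and this \<open>b\<close> makes it equal to -1.\<close>
        using *[of 1 "- (B y y + 1) / (2 * B y z)"] pos[of y] True by (simp add: field_simps)
    qed
    then show ?thesis using True by simp
  next
    case False
    then have "B z z > 0" using pos[of z] by simp
    moreover have "0 \<le> B z z * (B y y * B z z - (B y z)\<^sup>2)"
      using *[of "B z z" "- B y z"] by (simp add: power2_eq_square algebra_simps)
    ultimately show ?thesis by (simp add: zero_le_mult_iff)
  qed
qed

lemma bilinear_sqrt_triangle:
  fixes B :: "'a::real_normed_vector \<Rightarrow> 'a \<Rightarrow> real"
  assumes B: "bounded_bilinear B" and sym: "\<And>y z. B y z = B z y" and pos: "\<And>y. B y y \<ge> 0"
  shows "sqrt (B (y + z) (y + z)) \<le> sqrt (B y y) + sqrt (B z z)"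
proof (rule real_le_lsqrt)
  interpret bounded_bilinear B by fact
  have "B y z \<le> sqrt ((B y z)\<^sup>2)" by simp
  also have "\<dots> \<le> sqrt (B y y * B z z)"
    using bilinear_cauchy_schwarz[OF assms] by (intro real_sqrt_le_mono)
  finally have "B y z \<le> sqrt (B y y) * sqrt (B z z)" by (simp add: real_sqrt_mult)
  then show "B (y + z) (y + z) \<le> (sqrt (B y y) + sqrt (B z z))\<^sup>2"
    using sym[of z y] pos by (simp add: add_left add_right power2_sum)
qed (use pos in auto)

text \<open>The derivative is only controlled below the level \<open>v\<close>; the first time at which the level
  would be reached gives a contradiction.\<close>

lemma nonincreasing_below_level:
  fixes g g' :: "real \<Rightarrow> real"
  assumes der: "\<And>\<tau>. \<tau> \<in> {s..t} \<Longrightarrow> (g has_real_derivative g' \<tau>) (at \<tau> within {s..t})"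
    and nonpos: "\<And>\<tau>. \<tau> \<in> {s..t} \<Longrightarrow> g \<tau> \<le> v \<Longrightarrow> g' \<tau> \<le> 0"
    and "g s < v" "\<tau> \<in> {s..t}"
  shows "g \<tau> \<le> g s"
proof -
  have cont: "continuous_on {s..t} g"
    by (rule DERIV_continuous_on) (use der in auto)
  have at: "(g has_real_derivative g' \<sigma>) (at \<sigma>)" if "s < \<sigma>" "\<sigma> < t" for \<sigma>
    using der[of \<sigma>] that by (simp add: at_within_Icc_at)
  \<comment> \<open>The bound by \<open>v\<close> is asked only on the open interval, so
    \<open>\<xi>\<close> may be the first time at which the level is reached.\<close>
  have mono: "g \<xi> \<le> g s" if \<xi>: "\<xi> \<in> {s..t}" and le: "\<And>\<sigma>. \<sigma> \<in> {s<..<\<xi>} \<Longrightarrow> g \<sigma> \<le> v" for \<xi>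
  proof (rule DERIV_nonpos_imp_decreasing_open[where f = g and a = s and b = \<xi>])
    show "continuous_on {s..\<xi>} g" by (rule continuous_on_subset[OF cont]) (use \<xi> in auto)
    show "\<exists>y. (g has_real_derivative y) (at \<sigma>) \<and> y \<le> 0" if "s < \<sigma>" "\<sigma> < \<xi>" for \<sigma>
      using at[of \<sigma>] nonpos[of \<sigma>] le[of \<sigma>] that \<xi> by auto
  qed (use \<xi> in auto)
  have below: "g \<sigma> < v" if "\<sigma> \<in> {s..t}" for \<sigma>
  proof (rule ccontr)
    assume "\<not> g \<sigma> < v"
    define X where "X = {s..t} \<inter> g -` {v..}"
    have "closed X"
      unfolding X_def by (intro continuous_closed_preimage cont) auto
    moreover have "\<sigma> \<in> X" using that \<open>\<not> g \<sigma> < v\<close> by (simp add: X_def)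
    moreover have bdd: "bdd_below X" by (rule bdd_belowI[of _ s]) (auto simp: X_def)
    ultimately have "Inf X \<in> X" by (intro closed_contains_Inf) auto
    moreover have "g \<xi> \<le> v" if "\<xi> \<in> {s<..<Inf X}" for \<xi>
    proof -
      have "\<xi> \<notin> X" using cInf_lower[OF _ bdd, of \<xi>] that by auto
      then show ?thesis using that \<open>Inf X \<in> X\<close> by (auto simp: X_def)
    qed
    ultimately have "g (Inf X) \<le> g s" "g (Inf X) \<ge> v" using mono[of "Inf X"] by (auto simp: X_def)
    then show False using \<open>g s < v\<close> by simp
  qed
  have "g \<sigma> \<le> v" if "\<sigma> \<in> {s<..<\<tau>}" for \<sigma>
    using below[of \<sigma>] that assms(4) by auto
  then show ?thesis using mono assms(4) by blast
qed

section \<open>The weight and exponential decay\<close>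

text \<open>The solution of \<open>w' = - C * exp (- t) * w\<close> with \<open>w 0 = 1\<close>. As
  \<open>C * exp (- t)\<close> has integral \<open>C\<close> over the half-line, it never falls
  below \<open>exp (- C)\<close>.\<close>

definition weight :: "real \<Rightarrow> real \<Rightarrow> real" where
  "weight C t = exp (- C * (1 - exp (- t)))"

lemma weight_pos: "weight C t > 0"
  by (simp add: weight_def)

lemma weight_le_1: "C \<ge> 0 \<Longrightarrow> t \<ge> 0 \<Longrightarrow> weight C t \<le> 1"
  by (simp add: weight_def)

lemma weight_ge: "C \<ge> 0 \<Longrightarrow> weight C t \<ge> exp (- C)"
  by (simp add: weight_def mult_left_le)

lemma weight_has_derivative: "(weight C has_real_derivative - C * exp (- t) * weight C t) (at t within S)"
  unfolding weight_def by (auto intro!: derivative_eq_intros)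

text \<open>The derivative of the weight cancels the growth term \<open>C * exp (- t) / 2\<close> of
  the rate. The bound \<open>exp (- C) * norm y ^ 2 \<le> weight C t * B y y\<close> turns smallness
  of the weighted form into \<open>norm y \<le> r\<close>, where the rate is valid.\<close>

lemma weighted_decay:
  fixes B :: "real ^ 'd \<Rightarrow> real ^ 'd \<Rightarrow> real"
  assumes B: "bounded_bilinear B" and sym: "\<And>y z. B y z = B z y" and ge: "\<And>y. norm y ^ 2 \<le> B y y"
    and "C \<ge> 0" "\<gamma> \<ge> 0" "r \<ge> 0"
    and rate: "\<And>t y. t \<ge> 0 \<Longrightarrow> norm y \<le> r \<Longrightarrow> B y (F t y) \<le> (C * exp (- t) / 2 - \<gamma>) * B y y"
    and "0 \<le> s" "s \<le> t" and val: "value_at F s \<eta> t w"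
    and small: "weight C s * B \<eta> \<eta> < exp (- C) * r\<^sup>2"
  shows "weight C t * B w w \<le> exp (- 2 * \<gamma> * (t - s)) * (weight C s * B \<eta> \<eta>)"
proof -
  interpret bounded_bilinear B by fact
  obtain y where y: "y s = \<eta>" "y t = w"
    "\<And>\<tau>. \<tau> \<in> {s..t} \<Longrightarrow> (y has_vector_derivative F \<tau> (y \<tau>)) (at \<tau> within {s..t})"
    using val by (auto simp: value_at_def)
  define V where "V \<tau> = weight C \<tau> * B (y \<tau>) (y \<tau>)" for \<tau>
  define V' where "V' \<tau> = weight C \<tau> * (2 * B (y \<tau>) (F \<tau> (y \<tau>)) - C * exp (- \<tau>) * B (y \<tau>) (y \<tau>))" for \<tau>
  have pos: "B z z \<ge> 0" for z using ge[of z] by (meson order_trans zero_le_power2)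
  have V: "(V has_real_derivative V' \<tau>) (at \<tau> within {s..t})" if "\<tau> \<in> {s..t}" for \<tau>
  proof -
    have "((\<lambda>\<tau>. B (y \<tau>) (y \<tau>)) has_real_derivative 2 * B (y \<tau>) (F \<tau> (y \<tau>))) (at \<tau> within {s..t})"
      using has_vector_derivative[OF y(3)[OF that] y(3)[OF that]] sym
      by (simp add: has_real_derivative_iff_has_vector_derivative)
    then show ?thesis unfolding V_def V'_def
      by (auto intro!: derivative_eq_intros weight_has_derivative simp: algebra_simps)
  qed
  have V'_le: "V' \<tau> \<le> - 2 * \<gamma> * V \<tau>" if "\<tau> \<in> {s..t}" "V \<tau> \<le> exp (- C) * r\<^sup>2" for \<tau>
  proof -
    have "exp (- C) * norm (y \<tau>) ^ 2 \<le> V \<tau>"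
      unfolding V_def by (intro mult_mono weight_ge ge less_imp_le[OF weight_pos]) (use \<open>C \<ge> 0\<close> in auto)
    also note that(2)
    finally have "norm (y \<tau>) \<le> r" using \<open>r \<ge> 0\<close> by (simp add: power2_le_iff_abs_le)
    then have "2 * B (y \<tau>) (F \<tau> (y \<tau>)) - C * exp (- \<tau>) * B (y \<tau>) (y \<tau>) \<le> - 2 * \<gamma> * B (y \<tau>) (y \<tau>)"
      using rate[of \<tau> "y \<tau>"] that \<open>0 \<le> s\<close> by (simp add: algebra_simps)
    from mult_left_mono[OF this less_imp_le[OF weight_pos[of C \<tau>]]] show ?thesis
      unfolding V'_def V_def by (simp add: algebra_simps)
  qed
  have V_nonneg: "V \<tau> \<ge> 0" for \<tau> using pos[of "y \<tau>"] weight_pos[of C \<tau>] by (simp add: V_def)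
  \<comment> \<open>Bootstrap: below the level \<open>V\<close> cannot grow, so it never reaches the
    level and the rate holds on all of \<open>{s..t}\<close>.\<close>
  have below: "V \<tau> \<le> exp (- C) * r\<^sup>2" if "\<tau> \<in> {s..t}" for \<tau>
  proof -
    have "V \<tau> \<le> V s"
    proof (rule nonincreasing_below_level[OF V])
      show "V' \<tau> \<le> 0" if "\<tau> \<in> {s..t}" "V \<tau> \<le> exp (- C) * r\<^sup>2" for \<tau>
        using V'_le[OF that] mult_nonneg_nonneg[OF \<open>\<gamma> \<ge> 0\<close> V_nonneg[of \<tau>]] by simp
      show "V s < exp (- C) * r\<^sup>2" using small y by (simp add: V_def)
    qed (use that in auto)
    then show ?thesis using small y by (simp add: V_def)
  qed
  define W where "W \<tau> = exp (2 * \<gamma> * \<tau>) * V \<tau>" for \<tau>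
  have "W t \<le> W s"
  \<comment> \<open>The derivative of \<open>W\<close> is now nonpositive throughout, so any level
    above \<open>W s\<close> will do.\<close>
  proof (rule nonincreasing_below_level[where g = W and s = s and t = t and \<tau> = t and v = "W s + 1"])
    show "(W has_real_derivative exp (2 * \<gamma> * \<tau>) * (2 * \<gamma> * V \<tau> + V' \<tau>)) (at \<tau> within {s..t})"
      if "\<tau> \<in> {s..t}" for \<tau>
      unfolding W_def using V[OF that] by (auto intro!: derivative_eq_intros simp: algebra_simps)
    show "exp (2 * \<gamma> * \<tau>) * (2 * \<gamma> * V \<tau> + V' \<tau>) \<le> 0" if "\<tau> \<in> {s..t}" for \<tau>
      using V'_le[OF that below[OF that]] by (simp add: mult_le_0_iff)
    show "W s < W s + 1" by simp
  qed (use \<open>s \<le> t\<close> in auto)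
  then have "V t \<le> exp (2 * \<gamma> * s) * V s / exp (2 * \<gamma> * t)"
    by (simp add: W_def pos_le_divide_eq mult.commute)
  also have "\<dots> = exp (2 * \<gamma> * s) / exp (2 * \<gamma> * t) * V s" by simp
  also have "exp (2 * \<gamma> * s) / exp (2 * \<gamma> * t) = exp (- 2 * \<gamma> * (t - s))"
    unfolding exp_diff[symmetric] by (simp add: algebra_simps)
  finally show ?thesis using y by (simp add: V_def)
qed

section \<open>The discrete steps\<close>

text \<open>A linear bound for the contraction over one step. Giving up half of the slope is the
  source of the 2 in the level \<open>2 * c / \<gamma>\<close>.\<close>

lemma exp_minus_le:
  fixes x :: real
  assumes "0 \<le> x" "x \<le> 1"
  shows "exp (- x) \<le> 1 - x / 2"
proof -
  have "exp (- x) \<le> 1 / (1 + x)"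
    using exp_ge_add_one_self[of x] assms by (simp add: exp_minus field_simps)
  also have "\<dots> \<le> 1 - x / 2"
    using assms mult_left_mono[of x 1 x] by (simp add: field_simps)
  finally show ?thesis .
qed

text \<open>The level \<open>?K\<close> is invariant: one step of decay frees at least
  \<open>c * h * \<alpha> h\<close>, the most that a kick can add. Only decay, vanishing at zero and
  the cost of a kick enter, so \<open>N\<close> stays abstract.\<close>

lemma approximation_bound:
  fixes N :: "real \<Rightarrow> real ^ 'd \<Rightarrow> real"
  assumes decay: "\<And>s t \<eta> w. 0 \<le> s \<Longrightarrow> s \<le> t \<Longrightarrow> value_at F s \<eta> t w \<Longrightarrow> N s \<eta> < \<rho> \<Longrightarrow>
      N t w \<le> exp (- \<gamma> * (t - s)) * N s \<eta>"
    and N_0: "\<And>t. N t 0 = 0"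
    and N_add: "\<And>t y z. t \<ge> 0 \<Longrightarrow> N t (y + z) \<le> N t y + c * norm z"
    and "\<gamma> > 0" "c \<ge> 0" "h > 0" "\<gamma> * h \<le> 1" "\<alpha> h \<ge> 0" "2 * c / \<gamma> * \<alpha> h < \<rho>"
    and yt: "yt \<in> approximations F \<alpha> h T" and "T \<ge> 0"
  shows "N T (yt T) \<le> 2 * c / \<gamma> * \<alpha> h"
proof -
  let ?K = "2 * c / \<gamma> * \<alpha> h"
  have K: "?K \<ge> 0" using assms by simp
  have decay': "N t w \<le> exp (- \<gamma> * (t - s)) * ?K"
    if "0 \<le> s" "s \<le> t" "value_at F s \<eta> t w" "N s \<eta> \<le> ?K" for s t \<eta> w
    using decay[OF that(1-3)] that(4) assms(9) mult_left_mono[OF that(4), of "exp (- \<gamma> * (t - s))"] by simp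
  obtain v where v: "\<And>n. n \<ge> 1 \<Longrightarrow> norm (v n) \<le> 1" and y0: "yt 0 = 0"
    and step: "\<And>n. n \<ge> 1 \<Longrightarrow> real n * h \<le> T \<Longrightarrow> \<exists>w. value_at F (real (n - 1) * h) (yt (real (n - 1) * h)) (real n * h) w \<and>
             yt (real n * h) = w + (h * \<alpha> h) *\<^sub>R v n"
    and inter: "\<And>n t. n \<ge> 1 \<Longrightarrow> t\<in>{real (n - 1) * h..<real n * h} \<Longrightarrow> t \<le> T \<Longrightarrow>
        value_at F (real (n - 1) * h) (yt (real (n - 1) * h)) t (yt t)"
    using yt unfolding approximations_def by blast
  have grid: "N (real n * h) (yt (real n * h)) \<le> ?K" if "real n * h \<le> T" for n
    using that
  proof (induction n)
    case 0
    then show ?case using K y0 N_0 by simp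
  next
    case (Suc n)
    have "real n * h \<le> real (Suc n) * h" using \<open>h > 0\<close> by simp
    with Suc have IH: "N (real n * h) (yt (real n * h)) \<le> ?K" by simp
    obtain w where w: "value_at F (real n * h) (yt (real n * h)) (real (Suc n) * h) w"
        "yt (real (Suc n) * h) = w + (h * \<alpha> h) *\<^sub>R v (Suc n)"
      using step[of "Suc n"] Suc.prems by auto
    have "N (real (Suc n) * h) w \<le> exp (- \<gamma> * (real (Suc n) * h - real n * h)) * ?K"
      by (rule decay'[OF _ _ w(1) IH]) (use \<open>h > 0\<close> in auto)
    also have "real (Suc n) * h - real n * h = h" by (simp add: algebra_simps)
    also have "exp (- \<gamma> * h) * ?K \<le> (1 - \<gamma> * h / 2) * ?K"
      using exp_minus_le[of "\<gamma> * h"] assms by (intro mult_right_mono[OF _ K]) auto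
    also have "\<dots> = ?K - c * (h * \<alpha> h)"
      using \<open>\<gamma> > 0\<close> by (simp add: field_simps)
    finally have 1: "N (real (Suc n) * h) w \<le> ?K - c * (h * \<alpha> h)" .
    have "N (real (Suc n) * h) (yt (real (Suc n) * h))
        \<le> N (real (Suc n) * h) w + c * norm ((h * \<alpha> h) *\<^sub>R v (Suc n))"
      unfolding w(2) by (rule N_add) (use \<open>h > 0\<close> in simp)
    also have "norm ((h * \<alpha> h) *\<^sub>R v (Suc n)) \<le> h * \<alpha> h"
      using v[of "Suc n"] assms(6,8) by (simp add: mult_left_le)
    finally show ?case using 1 \<open>c \<ge> 0\<close> by (simp add: mult_left_mono)
  qed
  \<comment> \<open>The last grid point not after \<open>T\<close>. The remaining piece, possibly of
    length zero, lies in the half-open interval with index \<open>Suc n\<close> and carries no kick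
    at its end.\<close>
  define n where "n = nat \<lfloor>T / h\<rfloor>"
  have n: "real n * h \<le> T" "T < real (Suc n) * h"
  proof -
    have "real n = of_int \<lfloor>T / h\<rfloor>" using \<open>T \<ge> 0\<close> \<open>h > 0\<close> by (simp add: n_def)
    then have "real n \<le> T / h" "T / h < real n + 1" by linarith+
    then show "real n * h \<le> T" "T < real (Suc n) * h" using \<open>h > 0\<close> by (auto simp: field_simps)
  qed
  then have "value_at F (real n * h) (yt (real n * h)) T (yt T)" using inter[of "Suc n" T] by auto
  then have "N T (yt T) \<le> exp (- \<gamma> * (T - real n * h)) * ?K"
    using n \<open>h > 0\<close> grid[OF n(1)] by (intro decay') auto
  also have "\<dots> \<le> ?K" using n(1) \<open>\<gamma> > 0\<close> K by (intro mult_left_le_one_le) auto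
  finally show ?thesis .
qed

section \<open>The rate of contraction near the trajectory\<close>

text \<open>Every entry is at most the norm. The crude constant turns continuity of the Jacobian
  into operator-norm estimates.\<close>

lemma onorm_matrix_le_norm:
  fixes A :: "real ^ 'n ^ 'm"
  shows "onorm ((*v) A) \<le> real CARD('m) * real CARD('n) * norm A"
  by (rule onorm_le_matrix_component)
    (metis component_le_norm_cart Finite_Cartesian_Product.norm_nth_le order_trans)

lemma C1_map_has_derivative:
  assumes "C1_map f"
  shows "(f has_derivative (*v) (jacobian f (at a))) (at a within S)"
  using assms unfolding C1_map_def differentiable_on_def
  by (metis UNIV_I has_derivative_at_withinI jacobian_works)

text \<open>Mean value inequality on a ball where the Jacobian is close to its value at
  \<open>p\<close>. Both points vary, because perturbations are measured from \<open>x t\<close>,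
  not from \<open>p\<close>.\<close>

lemma C1_map_linearization:
  fixes f :: "real ^ 'd \<Rightarrow> real ^ 'd"
  assumes "C1_map f" "e > 0"
  obtains \<delta> where "\<delta> > 0" "\<And>a b. a \<in> ball p \<delta> \<Longrightarrow> b \<in> ball p \<delta> \<Longrightarrow>
    norm (f b - f a - jacobian f (at p) *v (b - a)) \<le> e * norm (b - a)"
proof -
  let ?J = "\<lambda>a. jacobian f (at a)" and ?c = "real CARD('d) * real CARD('d)"
  have c: "?c > 0" by simp
  have "isCont ?J p"
    using assms(1) by (simp add: C1_map_def continuous_on_eq_continuous_at)
  \<comment> \<open>Dividing by \<open>?c\<close> compensates the constant of
    \<open>onorm_matrix_le_norm\<close>.\<close>
  then obtain \<delta> where \<delta>: "\<delta> > 0" "\<And>a. dist a p < \<delta> \<Longrightarrow> dist (?J a) (?J p) < e / ?c"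
    using \<open>e > 0\<close> c unfolding continuous_at_eps_delta by (metis divide_pos_pos)
  have "norm (f b - f a - ?J p *v (b - a)) \<le> e * norm (b - a)"
    if "a \<in> ball p \<delta>" "b \<in> ball p \<delta>" for a b
  proof -
    have "norm (f b - f a - ?J p *v (b - a)) \<le> norm (b - a) * e"
    proof (rule differentiable_bound_linearization[where S = "ball p \<delta>" and f' = "\<lambda>a. (*v) (?J a)"])
      show "a + t *\<^sub>R (b - a) \<in> ball p \<delta>" if "t \<in> {0..1}" for t
        using convexD_alt[OF convex_ball \<open>a \<in> _\<close> \<open>b \<in> _\<close>, of t] that
        by (simp add: algebra_simps)
      show "onorm ((*v) (?J x) - (*v) (?J p)) \<le> e" if "x \<in> ball p \<delta>" for x
      proof -
        have "(*v) (?J x) - (*v) (?J p) = (*v) (?J x - ?J p)"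
          by (simp add: fun_eq_iff matrix_vector_mult_diff_rdistrib)
        then have "onorm ((*v) (?J x) - (*v) (?J p)) \<le> ?c * norm (?J x - ?J p)"
          by (simp only: onorm_matrix_le_norm)
        also have "\<dots> \<le> ?c * (e / ?c)"
          using \<delta>(2)[of x] that by (intro mult_left_mono) (auto simp: dist_norm norm_minus_commute)
        finally show ?thesis using c by simp
      qed
    qed (use \<delta>(1) C1_map_has_derivative[OF assms(1)] in auto)
    then show ?thesis by (simp add: mult.commute)
  qed
  then show ?thesis using that \<delta>(1) by blast
qed

lemma C1_map_lipschitz:
  fixes f :: "real ^ 'd \<Rightarrow> real ^ 'd"
  assumes "C1_map f" "compact S" "convex S"
  obtains L where "L \<ge> 0" "\<And>a b. a \<in> S \<Longrightarrow> b \<in> S \<Longrightarrow> norm (f b - f a) \<le> L * norm (b - a)"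
proof -
  let ?J = "\<lambda>a. jacobian f (at a)" and ?c = "real CARD('d) * real CARD('d)"
  have "continuous_on S ?J"
    using assms(1) continuous_on_subset unfolding C1_map_def by blast
  then have "bounded (?J ` S)"
    using assms(2) by (intro compact_imp_bounded compact_continuous_image)
  then obtain b where b: "b > 0" "\<And>a. a \<in> S \<Longrightarrow> norm (?J a) \<le> b"
    unfolding bounded_pos by auto
  have "onorm ((*v) (?J a)) \<le> ?c * b" if "a \<in> S" for a
    by (rule order_trans[OF onorm_matrix_le_norm]) (use b(2)[OF that] in \<open>auto intro: mult_left_mono\<close>)
  then have "norm (f b' - f a) \<le> ?c * b * norm (b' - a)" if "a \<in> S" "b' \<in> S" for a b'
    by (intro differentiable_bound[OF assms(3) C1_map_has_derivative[OF assms(1)]] that)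
  then show ?thesis using that[of "?c * b"] b(1) by auto
qed

lemma convergent_trajectory_bounded:
  assumes "trajectory f x0 x" "(x \<longlongrightarrow> p) at_top"
  obtains R where "\<And>t. t \<ge> 0 \<Longrightarrow> norm (x t) \<le> R"
proof -
  have "eventually (\<lambda>t. dist (x t) p < 1) at_top" using tendstoD[OF assms(2)] by simp
  then obtain T where T: "\<And>t. t \<ge> T \<Longrightarrow> dist (x t) p < 1" by (auto simp: eventually_at_top_linorder)
  have "continuous_on {0..} x"
    using assms(1) unfolding trajectory_def continuous_on_eq_continuous_within
    by (auto intro: has_vector_derivative_continuous)
  then have "bounded (x ` {0..T})"
    by (intro compact_imp_bounded compact_continuous_image) (auto intro: continuous_on_subset)
  then obtain b where b: "\<And>t. t \<in> {0..T} \<Longrightarrow> norm (x t) \<le> b"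
    unfolding bounded_iff by blast
  have "norm (x t) \<le> max b (norm p + 1)" if "t \<ge> 0" for t
  proof (cases "t \<le> T")
    case False
    then show ?thesis using T[of t] norm_triangle_ineq2[of "x t" p] by (simp add: dist_norm)
  qed (use b[of t] that in simp)
  then show ?thesis by (rule that)
qed

text \<open>Up to some time \<open>T\<close> the Lipschitz constant bounds the growth, and \<open>C\<close> is chosen so large
  that \<open>C exp (- t)\<close> dominates it; after \<open>T\<close> the linearization at \<open>p\<close> contracts.\<close>

lemma trajectory_rate:
  fixes f :: "real ^ 'd \<Rightarrow> real ^ 'd"
  assumes f: "C1_map f" and x: "trajectory f x0 x" "(x \<longlongrightarrow> p) at_top"
    and B: "bounded_bilinear B" and ge: "\<And>y. norm y ^ 2 \<le> (B y y :: real)"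
    and "\<beta> > 0" and lyap: "\<And>y. B y (jacobian f (at p) *v y) \<le> - \<beta> * B y y"
  obtains C r where "C \<ge> 0" "r > 0" "\<And>t y. t \<ge> 0 \<Longrightarrow> norm y \<le> r \<Longrightarrow>
    B y (f (y + x t) - f (x t)) \<le> (C * exp (- t) / 2 - \<beta> / 2) * B y y"
proof -
  interpret bounded_bilinear B by fact
  obtain K where K: "K > 0" "\<And>y z. norm (B y z) \<le> norm y * norm z * K"
    using pos_bounded by blast
  have pos: "B z z \<ge> 0" for z using ge[of z] by (meson order_trans zero_le_power2)
  have B_le: "B y z \<le> K * l * B y y" if "norm z \<le> l * norm y" "l \<ge> 0" for y z l
  proof -
    have "B y z \<le> norm y * norm z * K" using K(2)[of y z] by simp
    also have "\<dots> \<le> norm y * (l * norm y) * K"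
      using that K(1) by (intro mult_right_mono mult_left_mono) auto
    also have "\<dots> = K * l * norm y ^ 2" by (simp add: power2_eq_square)
    also have "\<dots> \<le> K * l * B y y" using ge[of y] K(1) that by (intro mult_left_mono) auto
    finally show ?thesis .
  qed
  \<comment> \<open>With \<open>\<beta> / (2 * K)\<close> the nonlinear remainder costs at most half
    of the linear decay rate \<open>\<beta>\<close>.\<close>
  obtain \<delta> where \<delta>: "\<delta> > 0" and lin: "\<And>a b. a \<in> ball p \<delta> \<Longrightarrow> b \<in> ball p \<delta> \<Longrightarrow>
      norm (f b - f a - jacobian f (at p) *v (b - a)) \<le> \<beta> / (2 * K) * norm (b - a)"
    using C1_map_linearization[OF f, of "\<beta> / (2 * K)" p] \<open>\<beta> > 0\<close> K(1) by auto
  have "eventually (\<lambda>t. dist (x t) p < \<delta> / 2) at_top" using tendstoD[OF x(2), of "\<delta> / 2"] \<delta> by simp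
  then obtain T where T: "\<And>t. t \<ge> T \<Longrightarrow> dist (x t) p < \<delta> / 2"
    by (auto simp: eventually_at_top_linorder)
  obtain R where R: "\<And>t. t \<ge> 0 \<Longrightarrow> norm (x t) \<le> R"
    using convergent_trajectory_bounded[OF x] by blast
  obtain L where L: "L \<ge> 0" "\<And>a b. a \<in> cball 0 (R + 1) \<Longrightarrow> b \<in> cball 0 (R + 1) \<Longrightarrow>
      norm (f b - f a) \<le> L * norm (b - a)"
    using C1_map_lipschitz[OF f compact_cball convex_cball] by metis
  \<comment> \<open>This makes \<open>C * exp (- t) / 2\<close> equal to
    \<open>(K * L + \<beta> / 2) * exp (T - t)\<close>, which is at least
    \<open>K * L + \<beta> / 2\<close> up to time \<open>T\<close>.\<close>
  define C where "C = 2 * (K * L + \<beta> / 2) * exp T"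
  \<comment> \<open>The 1 keeps \<open>y + x t\<close> in the ball of radius \<open>R + 1\<close>;
    \<open>\<delta> / 2\<close> keeps it in \<open>ball p \<delta>\<close> after
    \<open>T\<close>.\<close>
  define r where "r = min 1 (\<delta> / 2)"
  have C: "C \<ge> 0" using K(1) L(1) \<open>\<beta> > 0\<close> by (simp add: C_def)
  have "r > 0" using \<delta> by (simp add: r_def)
  have "B y (f (y + x t) - f (x t)) \<le> (C * exp (- t) / 2 - \<beta> / 2) * B y y"
    if "t \<ge> 0" "norm y \<le> r" for t y
  proof (cases "t \<le> T")
    case True
    have "norm (y + x t) \<le> R + 1"
      using norm_triangle_ineq[of y "x t"] R[OF \<open>t \<ge> 0\<close>] that by (simp add: r_def)
    then have "norm (f (y + x t) - f (x t)) \<le> L * norm y"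
      using L(2)[of "x t" "y + x t"] R[OF \<open>t \<ge> 0\<close>] by simp
    then have "B y (f (y + x t) - f (x t)) \<le> K * L * B y y" using L(1) by (rule B_le)
    also have "K * L \<le> C * exp (- t) / 2 - \<beta> / 2"
    proof -
      have "K * L + \<beta> / 2 \<le> (K * L + \<beta> / 2) * exp (T - t)"
        using True K(1) L(1) \<open>\<beta> > 0\<close> mult_left_mono[of 1 "exp (T - t)" "K * L + \<beta> / 2"] by simp
      then show ?thesis by (simp add: C_def exp_diff exp_minus field_simps)
    qed
    finally show ?thesis using pos[of y] by (simp add: mult_right_mono)
  next
    case False
    let ?e = "f (y + x t) - f (x t) - jacobian f (at p) *v y"
    have "dist (x t) p < \<delta> / 2" using T False by simp
    moreover have "dist (y + x t) p \<le> norm y + dist (x t) p"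
      unfolding dist_norm by (metis add_diff_eq norm_triangle_ineq)
    ultimately have "norm ?e \<le> \<beta> / (2 * K) * norm y"
      using lin[of "x t" "y + x t"] that \<delta> by (simp add: dist_commute r_def)
    then have "B y ?e \<le> K * (\<beta> / (2 * K)) * B y y"
      using K(1) \<open>\<beta> > 0\<close> by (intro B_le) auto
    then have "B y (f (y + x t) - f (x t)) \<le> - \<beta> * B y y + \<beta> / 2 * B y y"
      using lyap[of y] K(1) by (simp add: diff_right)
    also have "\<dots> \<le> (C * exp (- t) / 2 - \<beta> / 2) * B y y"
      using C pos[of y] by (simp add: algebra_simps)
    finally show ?thesis .
  qed
  then show ?thesis using that C \<open>r > 0\<close> by blast
qed

section \<open>Boundedness of the error growth\<close>

lemma eventually_at_right_admissible_scale:
  assumes \<alpha>: "admissible_scale \<alpha>" and "\<epsilon> > 0"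
  shows "\<forall>\<^sub>F h in at_right 0. 0 < \<alpha> h \<and> \<alpha> h < \<epsilon>"
proof -
  have "(\<alpha> \<longlongrightarrow> 0) (at 0 within {0..})"
    using \<alpha> unfolding admissible_scale_def continuous_on_def by (metis atLeast_iff order_refl)
  then have "(\<alpha> \<longlongrightarrow> 0) (at_right 0)" by (rule tendsto_within_subset) auto
  then have "\<forall>\<^sub>F h in at_right 0. \<alpha> h < \<epsilon>" using \<open>\<epsilon> > 0\<close> by (rule order_tendstoD)
  moreover have "0 < \<alpha> h" if "h > 0" for h
    using \<alpha> that unfolding admissible_scale_def
    by (metis atLeast_iff less_imp_le order_refl strict_mono_onD)
  then have "\<forall>\<^sub>F h in at_right 0. 0 < \<alpha> h"
    using eventually_at_right_less[of "0 :: real"] by (rule eventually_mono[rotated])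
  ultimately show ?thesis by eventually_elim simp
qed

theorem theorem7p1:
  fixes f :: "real ^ 'd \<Rightarrow> real ^ 'd"
    and x :: "real \<Rightarrow> real ^ 'd"
    and x0 p :: "real ^ 'd"
  assumes "C1_map f"
    and "trajectory f x0 x"
    and "hyperbolic_sink f p"
    and "(x \<longlongrightarrow> p) at_top"
  shows "\<exists>C::real. \<forall>\<alpha>. admissible_scale \<alpha> \<longrightarrow>
           (\<forall>t\<ge>0. trajectory_error_growth f x \<alpha> t \<le> ereal C)"
proof -
  define F where "F = (\<lambda>t y. f (y + x t) - f (x t))"
  obtain B \<beta> where B: "bounded_bilinear B" "\<And>y z. B y z = (B z y :: real)"
      "\<And>y. norm y ^ 2 \<le> B y y" and \<beta>: "\<beta> > 0" "\<And>y. B y (jacobian f (at p) *v y) \<le> - \<beta> * B y y"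
    using stable_matrix_lyapunov[of "jacobian f (at p)"] assms(3) by (auto simp: hyperbolic_sink_def)
  interpret bounded_bilinear B by (rule B)
  obtain C r where C: "C \<ge> 0" and r: "r > 0" and rate: "\<And>t y. t \<ge> 0 \<Longrightarrow> norm y \<le> r \<Longrightarrow>
      B y (F t y) \<le> (C * exp (- t) / 2 - \<beta> / 2) * B y y"
    by (rule trajectory_rate[OF assms(1,2,4) B(1,3) \<beta>], rule that, unfold F_def)
  have pos: "B z z \<ge> 0" for z using B(3)[of z] by (meson order_trans zero_le_power2)
  define \<gamma> where "\<gamma> = \<beta> / 2"
  have \<gamma>: "\<gamma> > 0" using \<beta>(1) by (simp add: \<gamma>_def)
  define N where "N t z = sqrt (weight C t * B z z)" for t z
  obtain K where K: "K > 0" "\<And>y z. norm (B y z) \<le> norm y * norm z * K" using pos_bounded by blast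
  \<comment> \<open>The square root of the smallness threshold in
    \<open>weighted_decay\<close>.\<close>
  define \<rho> where "\<rho> = exp (- C / 2) * r"
  have \<rho>: "\<rho> > 0" "\<rho>\<^sup>2 = exp (- C) * r\<^sup>2"
    using r by (auto simp: \<rho>_def power_mult_distrib exp_double[symmetric])
  have N_sq: "(N t z)\<^sup>2 = weight C t * B z z" for t z
    using pos[of z] weight_pos[of C t] by (simp add: N_def)
  have N_nonneg: "N t z \<ge> 0" for t z
    using pos[of z] weight_pos[of C t] by (simp add: N_def)
  have decay: "N t w \<le> exp (- \<gamma> * (t - s)) * N s \<eta>"
    if "0 \<le> s" "s \<le> t" "value_at F s \<eta> t w" "N s \<eta> < \<rho>" for s t \<eta> w
  proof (rule power2_le_imp_le)
    have "weight C s * B \<eta> \<eta> < exp (- C) * r\<^sup>2"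
      using power_strict_mono[OF that(4) N_nonneg, of 2] by (simp add: N_sq \<rho>)
    then have "weight C t * B w w \<le> exp (- 2 * \<gamma> * (t - s)) * (weight C s * B \<eta> \<eta>)"
      using C r \<gamma> rate that(1-3) B by (intro weighted_decay[where r = r]) (auto simp: \<gamma>_def)
    then show "(N t w)\<^sup>2 \<le> (exp (- \<gamma> * (t - s)) * N s \<eta>)\<^sup>2"
      by (simp add: N_sq power_mult_distrib exp_double[symmetric] algebra_simps)
  qed (simp add: N_nonneg)
  have N_add: "N t (y + z) \<le> N t y + sqrt K * norm z" if "t \<ge> 0" for t y z
  proof -
    have "N t (y + z) \<le> N t y + N t z"
      using bilinear_sqrt_triangle[OF B(1,2) pos, of y z] weight_pos[of C t]
      by (simp add: N_def real_sqrt_mult distrib_left[symmetric])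
    also have "N t z \<le> sqrt (B z z)"
      using weight_le_1[OF C that] weight_pos[of C t] pos[of z]
      unfolding N_def by (simp add: mult_left_le_one_le)
    also have "\<dots> \<le> sqrt (K * (norm z)\<^sup>2)"
      using K(2)[of z z] by (simp add: power2_eq_square mult.commute)
    finally show ?thesis by (simp add: real_sqrt_mult)
  qed
  \<comment> \<open>Returning to the Euclidean norm costs a factor independent of \<open>t\<close>,
    as the weight is bounded below.\<close>
  have norm_le: "norm z \<le> exp (C / 2) * N t z" for t z
  proof (rule power2_le_imp_le)
    have "exp (- C) * (norm z)\<^sup>2 \<le> (N t z)\<^sup>2"
      unfolding N_sq by (intro mult_mono weight_ge[OF C] B(3)) (auto intro: less_imp_le weight_pos)
    then show "(norm z)\<^sup>2 \<le> (exp (C / 2) * N t z)\<^sup>2"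
      by (simp add: power_mult_distrib exp_double[symmetric] exp_minus field_simps)
  qed (simp add: N_nonneg)
  \<comment> \<open>The invariant level of \<open>approximation_bound\<close>, divided by
    \<open>\<alpha> h\<close>, for the kick cost \<open>sqrt K\<close> from
    \<open>N_add\<close>.\<close>
  define c where "c = 2 * sqrt K / \<gamma>"
  have c: "c > 0" using K(1) \<gamma> by (simp add: c_def)
  have "error_growth F \<alpha> t \<le> ereal (exp (C / 2) * c)" if \<alpha>: "admissible_scale \<alpha>" and "t \<ge> 0" for \<alpha> t
    unfolding error_growth_def
  proof (rule Limsup_bounded)
    have "\<forall>\<^sub>F h in at_right 0. 0 < \<alpha> h \<and> \<alpha> h < \<rho> / c"
      \<comment> \<open>Below \<open>\<rho> / c\<close> the level \<open>c * \<alpha> h\<close>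
        stays under \<open>\<rho>\<close>, where decay is known.\<close>
      using \<alpha> \<rho>(1) c by (intro eventually_at_right_admissible_scale) auto
    moreover have "\<forall>\<^sub>F h in at_right 0. h \<in> {0<..<1 / \<gamma>}"
      using \<gamma> by (intro eventually_at_right_real) simp
    ultimately show "\<forall>\<^sub>F h in at_right 0. max_error F \<alpha> t h / ereal (\<alpha> h) \<le> ereal (exp (C / 2) * c)"
    proof eventually_elim
      case (elim h)
      have "max_error F \<alpha> t h \<le> ereal (exp (C / 2) * c * \<alpha> h)"
        unfolding max_error_def
      proof (rule SUP_least)
        fix yt assume yt: "yt \<in> approximations F \<alpha> h t"
        have "N t (yt t) \<le> c * \<alpha> h"
          unfolding c_def
          by (rule approximation_bound[OF decay _ N_add \<gamma> _ _ _ _ _ yt \<open>t \<ge> 0\<close>])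
            (use K(1) \<gamma> c elim in \<open>auto simp: N_def zero_left c_def field_simps\<close>)
        then have "exp (C / 2) * N t (yt t) \<le> exp (C / 2) * (c * \<alpha> h)"
          by (rule mult_left_mono) simp
        from order_trans[OF norm_le this]
        show "ereal (norm (yt t)) \<le> ereal (exp (C / 2) * c * \<alpha> h)"
          by (simp add: mult.assoc)
      qed
      then show ?case
        using elim by (subst ereal_divide_le_pos) (auto simp: mult.commute)
    qed
  qed
  then show ?thesis unfolding trajectory_error_growth_def F_def by blast
qed

end
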